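(* Let $\Omega\subset\mathbb{R}^n\times(-\infty,\infty)$ be a domain and let $\{u_p\}_p$ be a sequence such that each $u_p$ is a viscosity solution in $\Omega$ of $u_t-\mathcal{A}_pu=0$. Assume that $\{u_p\}_p$ contains a subsequence $\{u_{p_j}\}_j$, with $p_j\to\infty$ as $j\to\infty$, that converges uniformly in $\Omega$ to a function $u_\infty$. Then $u_\infty$ is a viscosity solution in $\Omega$ of the normalised $\infty$-parabolic equation $u_t-\Delta_\infty^Nu=0$.
   Context: Points of $\mathbb{R}^n\times\mathbb{R}$ are written $\zeta=(x,t)$; $Du$ and $D^2u$ are the gradient and Hessian in the spatial variable $x$ only. For $1<p<\infty$ and $Du\ne0$, $$\mathcal{A}_pu=\frac1p|Du|^{2-p}\,\mathrm{div}(|Du|^{p-2}Du)=\frac1p\mathrm{tr}(D^2u)+\frac{p-2}{p}\left\langle D^2u\frac{Du}{|Du|},\frac{Du}{|Du|}\right\rangle,\qquad \Delta_\infty^Nu=\left\langle D^2u\frac{Du}{|Du|},\frac{Du}{|Du|}\right\rangle .$$ For a symmetric matrix $X$ let $\lambda(X)$ and $\Lambda(X)$ be its smallest and largest eigenvalues. Viscosity solutions of $u_t=\mathcal{A}_pu$. A lower semicontinuous $u\in L^\infty(\Omega)$ is a viscosity supersolution in $\Omega$ if, whenever $\phi\in C^2(\Omega)$ and $u-\phi$ has a minimum at $\zeta_0\in\Omega$, one has $\phi_t(\zeta_0)-\mathcal{A}_p\phi(\zeta_0)\ge0$ if $D\phi(\zeta_0)\ne0$, and $\phi_t(\zeta_0)-\frac1p\mathrm{tr}(D^2\phi(\zeta_0))-\frac{p-2}{p}\lambda(D^2\phi(\zeta_0))\ge0$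 if $D\phi(\zeta_0)=0$. An upper semicontinuous $u\in L^\infty(\Omega)$ is a viscosity subsolution in $\Omega$ if, whenever $\phi\in C^2(\Omega)$ and $u-\phi$ has a maximum at $\zeta_0\in\Omega$, one has $\phi_t(\zeta_0)-\mathcal{A}_p\phi(\zeta_0)\le0$ if $D\phi(\zeta_0)\ne0$, and $\phi_t(\zeta_0)-\frac1p\mathrm{tr}(D^2\phi(\zeta_0))-\frac{p-2}{p}\Lambda(D^2\phi(\zeta_0))\le0$ if $D\phi(\zeta_0)=0$. (These are the conditions for $p\ge2$; for $1<p<2$, $\lambda$ and $\Lambda$ are interchanged.) A viscosity solution is a function that is both a viscosity sub- and supersolution. Viscosity solutions of $u_t=\Delta_\infty^Nu$. An upper semicontinuous $u$ is a viscosity subsolution in $\Omega$ if, whenever $\phi\in C^2(\Omega)$ and $u-\phi$ has a maximum at $\zeta_0\in\Omega$, one has $\phi_t(\zeta_0)-\Delta_\infty^N\phi(\zeta_0)\le0$ if $D\phi(\zeta_0)\ne0$, and $\phi_t(\zeta_0)-\Lambda(D^2\phi(\zeta_0))\le0$ if $D\phi(\zeta_0)=0$. A lower semicontinuous $u$ is a viscosity supersolution in $\Omega$ if, whenever $\phi\in C^2(\Omega)$ and $u-\phi$ has a minimum at $\zeta_0\in\Omega$, one has $\phi_t(\zeta_0)-\Delta_\infty^N\phi(\zeta_0)\ge0$ if $D\phi(\zeta_0)\ne0$, and $\phi_t(\zeta_0)-\lambda(D^2\phi(\zeta_0))\ge0$ if $D\phi(\zeta_0)=0$. A viscosity solution is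 both. *)

theory Defs
  imports "HOL-Analysis.Analysis"
begin

text \<open>
  A point \<open>(x, t)\<close> of space-time is a pair in \<open>(real^'n) \<times> real\<close>. Functions on
  a domain \<open>\<Omega>\<close> are total functions; only their values on \<open>\<Omega>\<close> matter.
\<close>

definition usc_on :: "'a::topological_space set \<Rightarrow> ('a \<Rightarrow> real) \<Rightarrow> bool" where
  "usc_on S u \<longleftrightarrow> (\<forall>x\<in>S. \<forall>c. u x < c \<longrightarrow> eventually (\<lambda>y. u y < c) (at x within S))"

definition lsc_on :: "'a::topological_space set \<Rightarrow> ('a \<Rightarrow> real) \<Rightarrow> bool" where
  "lsc_on S u \<longleftrightarrow> (\<forall>x\<in>S. \<forall>c. c < u x \<longrightarrow> eventually (\<lambda>y. c < u y) (at x within S))"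

definition in_L_infinity :: "'a::euclidean_space set \<Rightarrow> ('a \<Rightarrow> real) \<Rightarrow> bool" where
  "in_L_infinity S u \<longleftrightarrow>
     u \<in> borel_measurable (lebesgue_on S) \<and> (\<exists>M. AE x in lebesgue_on S. \<bar>u x\<bar> \<le> M)"

text \<open>Twice continuously (Frechet) differentiable in all variables jointly, for open \<open>S\<close>.\<close>

definition C2_on :: "'a::real_normed_vector set \<Rightarrow> ('a \<Rightarrow> real) \<Rightarrow> bool" where
  "C2_on S f \<longleftrightarrow>
     (\<exists>(f' :: 'a \<Rightarrow> 'a \<Rightarrow>\<^sub>L real) (f'' :: 'a \<Rightarrow> 'a \<Rightarrow>\<^sub>L 'a \<Rightarrow>\<^sub>L real).
        (\<forall>x\<in>S. (f has_derivative blinfun_apply (f' x)) (at x)) \<and>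
        (\<forall>x\<in>S. (f' has_derivative blinfun_apply (f'' x)) (at x)) \<and>
        continuous_on S f'')"

definition time_deriv :: "((real^'n) \<times> real \<Rightarrow> real) \<Rightarrow> (real^'n) \<times> real \<Rightarrow> real" where
  "time_deriv \<phi> \<zeta> = deriv (\<lambda>s. \<phi> (fst \<zeta>, s)) (snd \<zeta>)"

definition space_partial ::
    "'n::finite \<Rightarrow> ((real^'n) \<times> real \<Rightarrow> real) \<Rightarrow> (real^'n) \<times> real \<Rightarrow> real" where
  "space_partial i \<phi> \<zeta> = deriv (\<lambda>s. \<phi> (fst \<zeta> + s *\<^sub>R axis i 1, snd \<zeta>)) 0"

definition space_grad :: "((real^'n) \<times> real \<Rightarrow> real) \<Rightarrow> (real^'n) \<times> real \<Rightarrow> real^'n" where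
  "space_grad \<phi> \<zeta> = (\<chi> i. space_partial i \<phi> \<zeta>)"

definition space_hess :: "((real^'n) \<times> real \<Rightarrow> real) \<Rightarrow> (real^'n) \<times> real \<Rightarrow> real^'n^'n" where
  "space_hess \<phi> \<zeta> = (\<chi> i j. space_partial i (space_partial j \<phi>) \<zeta>)"

text \<open>
  The smallest and the largest eigenvalue are meaningful for symmetric matrices only,
  whose set of real eigenvalues is finite and nonempty.
\<close>

definition eigenvalues :: "real^'n^'n \<Rightarrow> real set" where
  "eigenvalues X = {c. \<exists>v. v \<noteq> 0 \<and> X *v v = c *\<^sub>R v}"

definition min_eigenvalue :: "real^'n^'n \<Rightarrow> real" where
  "min_eigenvalue X = Min (eigenvalues X)"

definition max_eigenvalue :: "real^'n^'n \<Rightarrow> real" where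
  "max_eigenvalue X = Max (eigenvalues X)"

text \<open>
  The normalised operators, in non-divergence form. They are meaningful where the spatial
  gradient does not vanish; there \<open>sgn (space_grad \<phi> \<zeta>)\<close> is the unit vector \<open>D\<phi> / |D\<phi>|\<close>.
\<close>

definition norm_inf_laplacian ::
    "((real^'n) \<times> real \<Rightarrow> real) \<Rightarrow> (real^'n) \<times> real \<Rightarrow> real" where
  "norm_inf_laplacian \<phi> \<zeta> =
     (space_hess \<phi> \<zeta> *v sgn (space_grad \<phi> \<zeta>)) \<bullet> sgn (space_grad \<phi> \<zeta>)"

definition norm_p_laplacian ::
    "real \<Rightarrow> ((real^'n) \<times> real \<Rightarrow> real) \<Rightarrow> (real^'n) \<times> real \<Rightarrow> real" where
  "norm_p_laplacian p \<phi> \<zeta> =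
     1 / p * trace (space_hess \<phi> \<zeta>) + (p - 2) / p * norm_inf_laplacian \<phi> \<zeta>"

text \<open>
  Test functions are \<open>C\<^sup>2\<close> on all of \<open>\<Omega>\<close>, and extrema of \<open>u - \<phi>\<close> are taken over all of \<open>\<Omega>\<close>.
\<close>

definition visc_supersol_p ::
    "real \<Rightarrow> ((real^'n) \<times> real) set \<Rightarrow> ((real^'n) \<times> real \<Rightarrow> real) \<Rightarrow> bool" where
  "visc_supersol_p p \<Omega> u \<longleftrightarrow>
     lsc_on \<Omega> u \<and> in_L_infinity \<Omega> u \<and>
     (\<forall>\<phi> \<zeta>\<^sub>0. C2_on \<Omega> \<phi> \<and> \<zeta>\<^sub>0 \<in> \<Omega> \<and> (\<forall>\<zeta>\<in>\<Omega>. u \<zeta>\<^sub>0 - \<phi> \<zeta>\<^sub>0 \<le> u \<zeta> - \<phi> \<zeta>) \<longrightarrow>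
        (if space_grad \<phi> \<zeta>\<^sub>0 \<noteq> 0
         then time_deriv \<phi> \<zeta>\<^sub>0 - norm_p_laplacian p \<phi> \<zeta>\<^sub>0 \<ge> 0
         else time_deriv \<phi> \<zeta>\<^sub>0 - 1 / p * trace (space_hess \<phi> \<zeta>\<^sub>0)
                - (p - 2) / p * (if p \<ge> 2 then min_eigenvalue (space_hess \<phi> \<zeta>\<^sub>0)
                                 else max_eigenvalue (space_hess \<phi> \<zeta>\<^sub>0)) \<ge> 0))"

definition visc_subsol_p ::
    "real \<Rightarrow> ((real^'n) \<times> real) set \<Rightarrow> ((real^'n) \<times> real \<Rightarrow> real) \<Rightarrow> bool" where
  "visc_subsol_p p \<Omega> u \<longleftrightarrow>
     usc_on \<Omega> u \<and> in_L_infinity \<Omega> u \<and>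
     (\<forall>\<phi> \<zeta>\<^sub>0. C2_on \<Omega> \<phi> \<and> \<zeta>\<^sub>0 \<in> \<Omega> \<and> (\<forall>\<zeta>\<in>\<Omega>. u \<zeta> - \<phi> \<zeta> \<le> u \<zeta>\<^sub>0 - \<phi> \<zeta>\<^sub>0) \<longrightarrow>
        (if space_grad \<phi> \<zeta>\<^sub>0 \<noteq> 0
         then time_deriv \<phi> \<zeta>\<^sub>0 - norm_p_laplacian p \<phi> \<zeta>\<^sub>0 \<le> 0
         else time_deriv \<phi> \<zeta>\<^sub>0 - 1 / p * trace (space_hess \<phi> \<zeta>\<^sub>0)
                - (p - 2) / p * (if p \<ge> 2 then max_eigenvalue (space_hess \<phi> \<zeta>\<^sub>0)
                                 else min_eigenvalue (space_hess \<phi> \<zeta>\<^sub>0)) \<le> 0))"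

definition visc_sol_p ::
    "real \<Rightarrow> ((real^'n) \<times> real) set \<Rightarrow> ((real^'n) \<times> real \<Rightarrow> real) \<Rightarrow> bool" where
  "visc_sol_p p \<Omega> u \<longleftrightarrow> visc_subsol_p p \<Omega> u \<and> visc_supersol_p p \<Omega> u"

definition visc_supersol_inf ::
    "((real^'n) \<times> real) set \<Rightarrow> ((real^'n) \<times> real \<Rightarrow> real) \<Rightarrow> bool" where
  "visc_supersol_inf \<Omega> u \<longleftrightarrow>
     lsc_on \<Omega> u \<and>
     (\<forall>\<phi> \<zeta>\<^sub>0. C2_on \<Omega> \<phi> \<and> \<zeta>\<^sub>0 \<in> \<Omega> \<and> (\<forall>\<zeta>\<in>\<Omega>. u \<zeta>\<^sub>0 - \<phi> \<zeta>\<^sub>0 \<le> u \<zeta> - \<phi> \<zeta>) \<longrightarrow>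
        (if space_grad \<phi> \<zeta>\<^sub>0 \<noteq> 0
         then time_deriv \<phi> \<zeta>\<^sub>0 - norm_inf_laplacian \<phi> \<zeta>\<^sub>0 \<ge> 0
         else time_deriv \<phi> \<zeta>\<^sub>0 - min_eigenvalue (space_hess \<phi> \<zeta>\<^sub>0) \<ge> 0))"

definition visc_subsol_inf ::
    "((real^'n) \<times> real) set \<Rightarrow> ((real^'n) \<times> real \<Rightarrow> real) \<Rightarrow> bool" where
  "visc_subsol_inf \<Omega> u \<longleftrightarrow>
     usc_on \<Omega> u \<and>
     (\<forall>\<phi> \<zeta>\<^sub>0. C2_on \<Omega> \<phi> \<and> \<zeta>\<^sub>0 \<in> \<Omega> \<and> (\<forall>\<zeta>\<in>\<Omega>. u \<zeta> - \<phi> \<zeta> \<le> u \<zeta>\<^sub>0 - \<phi> \<zeta>\<^sub>0) \<longrightarrow>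
        (if space_grad \<phi> \<zeta>\<^sub>0 \<noteq> 0
         then time_deriv \<phi> \<zeta>\<^sub>0 - norm_inf_laplacian \<phi> \<zeta>\<^sub>0 \<le> 0
         else time_deriv \<phi> \<zeta>\<^sub>0 - max_eigenvalue (space_hess \<phi> \<zeta>\<^sub>0) \<le> 0))"

definition visc_sol_inf ::
    "((real^'n) \<times> real) set \<Rightarrow> ((real^'n) \<times> real \<Rightarrow> real) \<Rightarrow> bool" where
  "visc_sol_inf \<Omega> u \<longleftrightarrow> visc_subsol_inf \<Omega> u \<and> visc_supersol_inf \<Omega> u"

end

theory Submission
  imports Defs
begin

text \<open>
  Viscosity inequalities pass to uniform limits because they are imposed only at maximum points,
  and maximum points are stable. Let \<open>u_inf - \<phi>\<close> have a maximum at \<open>a\<close>. Replacing \<open>\<phi>\<close> by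
  \<open>\<psi> = \<phi> + |z - a|\<^sup>4\<close> makes this maximum strict and keeps all derivatives of order at most two
  at \<open>a\<close>. By uniform convergence the functions \<open>u\<^sub>p - \<psi>\<close> have, for large \<open>p\<close>, maxima over all
  of \<open>\<Omega>\<close> at points that converge to \<open>a\<close> (\<open>maxima_of_perturbed_limit\<close>). They are attained
  because each \<open>u\<^sub>p\<close>, being semicontinuous from both sides, is continuous.

  At these points the equation for \<open>u\<^sub>p\<close> gives, whether or not the gradient of \<open>\<psi>\<close> vanishes
  there, an inequality \<open>\<psi>\<^sub>t \<le> tr X / p + (p - 2) / p * (X v \<bullet> v)\<close> with \<open>X\<close> the Hessian of
  \<open>\<psi>\<close> and \<open>v\<close> a unit vector (\<open>visc_subsol_p_unit_direction\<close>). As \<open>p \<rightarrow> \<infinity>\<close> only the last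
  term survives on the right. If the gradient of \<open>\<phi>\<close> at \<open>a\<close> is nonzero, \<open>v\<close> tends to its
  normalisation; if it is zero, \<open>X v \<bullet> v\<close> is bounded by the largest eigenvalue of the limiting
  Hessian plus an error that vanishes as \<open>X\<close> converges (\<open>quadratic_form_perturbation\<close>). Either
  way this is the required inequality (\<open>visc_subsol_inf_uniform_limit\<close>). The supersolution
  property follows by applying the same result to the negatives.

  Two standard facts enter: second derivatives are symmetric, so Hessians are symmetric matrices,
  and the largest eigenvalue of a symmetric matrix is the attained maximum of its quadratic form
  on unit vectors.
\<close>

section \<open>Symmetry of second derivatives\<close>

text \<open>
  Both values are the limit of one second difference: by the mean value theorem in the
  direction \<open>b\<close> and the expansion of \<open>f'\<close> at \<open>x\<close>,
  \<open>f (x + t a + t b) - f (x + t a) - f (x + t b) + f x = t\<^sup>2 f'' a b + o(t\<^sup>2)\<close>,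
  and the left-hand side is symmetric in \<open>a\<close> and \<open>b\<close>.
\<close>

lemma second_derivative_symmetric:
  fixes f :: "'a::real_normed_vector \<Rightarrow> real"
    and f' :: "'a \<Rightarrow> 'a \<Rightarrow>\<^sub>L real" and f'' :: "'a \<Rightarrow>\<^sub>L 'a \<Rightarrow>\<^sub>L real"
  assumes S: "open S" "x \<in> S"
    and f: "\<And>y. y \<in> S \<Longrightarrow> (f has_derivative f' y) (at y)"
    and f': "(f' has_derivative f'') (at x)"
  shows "f'' h k = f'' k h"
proof (rule ccontr)
  assume neq: "f'' h k \<noteq> f'' k h"
  define C where "C = (norm h + norm k)\<^sup>2"
  have "h \<noteq> 0" using neq by (auto simp: blinfun.bilinear_simps)
  then have hk: "norm h + norm k > 0" by (simp add: add_pos_nonneg)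
  then have C: "C > 0" by (simp add: C_def)
  \<comment> \<open>Each of the two orders costs an error of at most \<open>2 e t\<^sup>2 C\<close>; with this \<open>e\<close> the two
    errors together are half of the assumed discrepancy.\<close>
  define e where "e = \<bar>f'' h k - f'' k h\<bar> / (8 * C)"
  have e: "e > 0" using neq C by (simp add: e_def)
  obtain d0 where d0: "d0 > 0" "ball x d0 \<subseteq> S" using S by (meson openE)
  obtain d1 where d1: "d1 > 0"
    and rem: "\<And>y. norm (y - x) < d1 \<Longrightarrow> norm (f' y - f' x - f'' (y - x)) \<le> e * norm (y - x)"
    using f' e unfolding has_derivative_at_alt by meson
  define t where "t = min d0 d1 / 2 / (norm h + norm k)"
  have t: "t > 0" using d0 d1 hk by (simp add: t_def)
  have "norm h + norm k \<noteq> 0" using hk by simp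
  from iffD1[OF nonzero_eq_divide_eq[OF this] refl]
  have "t * (norm h + norm k) = min d0 d1 / 2" unfolding t_def .
  then have small: "t * (norm h + norm k) < d0" "t * (norm h + norm k) < d1"
    using d0 d1 by auto
  define \<Delta> where "\<Delta> = (\<lambda>a b. f (x + t *\<^sub>R a + t *\<^sub>R b) - f (x + t *\<^sub>R a) - f (x + t *\<^sub>R b) + f x)"
  have est: "\<bar>\<Delta> a b - t\<^sup>2 * f'' a b\<bar> \<le> 2 * e * t\<^sup>2 * C"
    if ab: "norm a + norm b = norm h + norm k" for a b
  proof -
    \<comment> \<open>The segments run over by the mean value theorem: from \<open>x + t a\<close> and from \<open>x\<close>, both in
      the direction \<open>t b\<close>.\<close>
    define P where "P = (\<lambda>s. t *\<^sub>R a + s *\<^sub>R (t *\<^sub>R b))"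
    define Q where "Q = (\<lambda>s::real. s *\<^sub>R (t *\<^sub>R b))"
    have bd: "norm (P s) \<le> t * (norm h + norm k)" "norm (Q s) \<le> t * (norm h + norm k)"
      if "0 \<le> s" "s \<le> 1" for s
    proof -
      have *: "s * (t * norm b) \<le> t * norm b"
        using that t by (simp add: mult_left_le_one_le)
      have "norm (P s) \<le> norm (t *\<^sub>R a) + norm (s *\<^sub>R (t *\<^sub>R b))"
        unfolding P_def by (rule norm_triangle_ineq)
      also have "\<dots> \<le> t * norm a + t * norm b" using that t * by simp
      finally show "norm (P s) \<le> t * (norm h + norm k)" by (simp add: ab[symmetric] algebra_simps)
      have "norm (Q s) \<le> t * norm b" using that t * by (simp add: Q_def)
      also have "\<dots> \<le> t * (norm a + norm b)" using t by simp
      finally show "norm (Q s) \<le> t * (norm h + norm k)" by (simp add: ab)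
    qed
    have inS: "x + P s \<in> S" "x + Q s \<in> S" if "0 \<le> s" "s \<le> 1" for s
      using bd[OF that] small d0 by (auto intro!: subsetD[OF d0(2)] simp: dist_norm)
    define g where "g = (\<lambda>s. f (x + P s) - f (x + Q s))"
    have g': "(g has_derivative (\<lambda>r. r * (f' (x + P s) (t *\<^sub>R b) - f' (x + Q s) (t *\<^sub>R b)))) (at s)"
      if "0 \<le> s" "s \<le> 1" for s
    proof -
      have "((\<lambda>s. f (x + P s)) has_derivative (\<lambda>r. f' (x + P s) (r *\<^sub>R (t *\<^sub>R b)))) (at s)"
      proof -
        have "((\<lambda>s. x + P s) has_derivative (\<lambda>r. r *\<^sub>R (t *\<^sub>R b))) (at s)"
          unfolding P_def by (auto intro!: derivative_eq_intros)
        from has_derivative_compose[OF this f[OF inS(1)[OF that]]] show ?thesis .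
      qed
      moreover have "((\<lambda>s. f (x + Q s)) has_derivative (\<lambda>r. f' (x + Q s) (r *\<^sub>R (t *\<^sub>R b)))) (at s)"
      proof -
        have "((\<lambda>s. x + Q s) has_derivative (\<lambda>r. r *\<^sub>R (t *\<^sub>R b))) (at s)"
          unfolding Q_def by (auto intro!: derivative_eq_intros)
        from has_derivative_compose[OF this f[OF inS(2)[OF that]]] show ?thesis .
      qed
      ultimately show ?thesis
        unfolding g_def by (auto intro!: derivative_eq_intros simp: blinfun.bilinear_simps algebra_simps)
    qed
    obtain s where s: "0 < s" "s < 1"
      and mvt: "g 1 - g 0 = (1 - 0) * (f' (x + P s) (t *\<^sub>R b) - f' (x + Q s) (t *\<^sub>R b))"
    proof -
      have "(g has_field_derivative (f' (x + P s) (t *\<^sub>R b) - f' (x + Q s) (t *\<^sub>R b))) (at s)"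
        if "0 \<le> s" "s \<le> 1" for s
        using g'[OF that] by (simp only: has_field_derivative_def mult.commute[of _ "_ - _"])
      then have "\<exists>s. 0 < s \<and> s < 1 \<and> g 1 - g 0 = (1 - 0) * (f' (x + P s) (t *\<^sub>R b) - f' (x + Q s) (t *\<^sub>R b))"
        by (intro MVT2) auto
      then show ?thesis using that by blast
    qed
    define R where "R = (\<lambda>y. f' (x + y) - f' x - f'' y)"
    have RP: "norm (R (P s)) \<le> e * (t * (norm h + norm k))"
      using rem[of "x + P s"] bd(1)[of s] s small e
      by (auto simp: R_def intro: order_trans[OF _ mult_left_mono])
    have RQ: "norm (R (Q s)) \<le> e * (t * (norm h + norm k))"
      using rem[of "x + Q s"] bd(2)[of s] s small e
      by (auto simp: R_def intro: order_trans[OF _ mult_left_mono])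
    have PQ: "P s = t *\<^sub>R a + Q s" by (simp add: P_def Q_def)
    have "\<Delta> a b = g 1 - g 0" by (simp add: \<Delta>_def g_def P_def Q_def algebra_simps)
    also have "\<dots> = t\<^sup>2 * f'' a b + (R (P s) - R (Q s)) (t *\<^sub>R b)"
      unfolding mvt R_def PQ by (simp add: blinfun.bilinear_simps power2_eq_square algebra_simps)
    finally have "\<bar>\<Delta> a b - t\<^sup>2 * f'' a b\<bar> = norm ((R (P s) - R (Q s)) (t *\<^sub>R b))" by simp
    also have "\<dots> \<le> norm (R (P s) - R (Q s)) * norm (t *\<^sub>R b)" by (rule norm_blinfun)
    also have "\<dots> \<le> (2 * (e * (t * (norm h + norm k)))) * (t * (norm h + norm k))"
    proof (rule mult_mono)
      show "norm (R (P s) - R (Q s)) \<le> 2 * (e * (t * (norm h + norm k)))"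
        using norm_triangle_ineq4[of "R (P s)" "R (Q s)"] RP RQ by simp
      show "norm (t *\<^sub>R b) \<le> t * (norm h + norm k)" using t by (simp add: ab[symmetric])
    qed (use t e in auto)
    finally show ?thesis by (simp add: C_def power2_eq_square algebra_simps)
  qed
  have "\<Delta> k h = \<Delta> h k" by (simp add: \<Delta>_def algebra_simps)
  then have "t\<^sup>2 * \<bar>f'' h k - f'' k h\<bar> \<le> 4 * e * t\<^sup>2 * C"
    using est[of h k] est[of k h]
    by (simp add: abs_mult_pos[symmetric] add.commute abs_le_iff algebra_simps abs_if split: if_splits)
  also have "\<dots> = t\<^sup>2 * (\<bar>f'' h k - f'' k h\<bar> / 2)" using C by (simp add: e_def)
  finally show False using t neq by simp
qed

section \<open>Extreme eigenvalues of symmetric matrices\<close>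

lemma quadratic_form_commute:
  fixes X :: "real^'n^'n"
  assumes "transpose X = X"
  shows "(X *v v) \<bullet> w = (X *v w) \<bullet> v"
  by (metis assms dot_lmul_matrix inner_commute vector_transpose_matrix)

text \<open>
  Eigenvectors of a symmetric matrix for distinct eigenvalues are orthogonal, hence linearly
  independent, and an independent set in a finite-dimensional space is finite. Without
  finiteness the \<open>Max\<close> that defines the largest eigenvalue would be an arbitrary number.
\<close>

lemma finite_eigenvalues_symmetric:
  fixes X :: "real^'n^'n"
  assumes X: "transpose X = X"
  shows "finite (eigenvalues X)"
proof -
  have "\<forall>c\<in>eigenvalues X. \<exists>v. v \<noteq> 0 \<and> X *v v = c *\<^sub>R v" by (auto simp: eigenvalues_def)
  then obtain V where V: "\<And>c. c \<in> eigenvalues X \<Longrightarrow> V c \<noteq> 0 \<and> X *v V c = c *\<^sub>R V c"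
    by metis
  have orth: "V c \<bullet> V d = 0" if "c \<in> eigenvalues X" "d \<in> eigenvalues X" "c \<noteq> d" for c d
  proof -
    have "c * (V c \<bullet> V d) = d * (V c \<bullet> V d)"
      using quadratic_form_commute[OF X, of "V c" "V d"] V that by (simp add: inner_commute)
    then show ?thesis using that by simp
  qed
  have "pairwise orthogonal (V ` eigenvalues X)"
    using orth by (auto simp: pairwise_def orthogonal_def)
  then have "independent (V ` eigenvalues X)"
    using V by (intro pairwise_orthogonal_independent) auto
  then have "finite (V ` eigenvalues X)" by (rule independent_imp_finite)
  moreover have "inj_on V (eigenvalues X)"
    using orth V by (metis inj_onI inner_eq_zero_iff)
  ultimately show ?thesis by (rule finite_imageD)
qed

text \<open>
  The quadratic form attains its maximum \<open>m\<close> over the compact unit sphere at some \<open>v\<close>. Then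
  \<open>m I - X\<close> is positive semidefinite and its quadratic form vanishes at \<open>v\<close>, which forces
  \<open>v\<close> into its kernel: otherwise moving from \<open>v\<close> along \<open>m v - X v\<close> would make the form
  negative.
\<close>

lemma rayleigh_maximum_is_eigenvalue:
  fixes X :: "real^'n^'n"
  assumes X: "transpose X = X"
  obtains v where "norm v = 1" "X *v v = ((X *v v) \<bullet> v) *\<^sub>R v"
    "\<And>w. (X *v w) \<bullet> w \<le> ((X *v v) \<bullet> v) * (w \<bullet> w)"
proof -
  have "continuous_on (sphere 0 1) (\<lambda>v::real^'n. (X *v v) \<bullet> v)"
    by (intro continuous_intros matrix_vector_mult_linear_continuous_on)
  moreover have "sphere (0::real^'n) 1 \<noteq> {}" by simp
  ultimately obtain v where v: "v \<in> sphere 0 1"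
    and max: "\<And>w. w \<in> sphere 0 1 \<Longrightarrow> (X *v w) \<bullet> w \<le> (X *v v) \<bullet> v"
    using continuous_attains_sup[of "sphere 0 1" "\<lambda>v::real^'n. (X *v v) \<bullet> v"] by auto
  define m where "m = (X *v v) \<bullet> v"
  have le: "(X *v w) \<bullet> w \<le> m * (w \<bullet> w)" for w
  proof (cases "w = 0")
    case False
    then have "(X *v sgn w) \<bullet> sgn w \<le> m" using max[of "sgn w"] by (simp add: norm_sgn m_def)
    then have "(norm w)\<^sup>2 * ((X *v sgn w) \<bullet> sgn w) \<le> (norm w)\<^sup>2 * m" by (simp add: mult_left_mono)
    moreover have "(norm w)\<^sup>2 * ((X *v sgn w) \<bullet> sgn w) = (X *v w) \<bullet> w"
      using False by (simp add: sgn_div_norm scaleR_matrix_vector_assoc[symmetric]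
          matrix_vector_mult_scaleR power2_eq_square field_simps)
    ultimately show ?thesis by (simp add: power2_norm_eq_inner mult.commute)
  qed simp
  define y where "y = m *\<^sub>R v - X *v v"
  have vv: "v \<bullet> v = 1" using v by (simp add: norm_eq_1)
  have nonneg: "0 \<le> 2 * s * (y \<bullet> y) + s\<^sup>2 * (m * (y \<bullet> y) - (X *v y) \<bullet> y)" for s
    using le[of "v + s *\<^sub>R y"] quadratic_form_commute[OF X, of y v] vv
    by (simp add: y_def m_def algebra_simps matrix_vector_mult_scaleR inner_commute power2_eq_square
       matrix_vector_right_distrib)
  have "y \<bullet> y = 0"
  proof (rule ccontr)
    assume "y \<bullet> y \<noteq> 0"
    then have yy: "y \<bullet> y > 0" by simp
    define K where "K = m * (y \<bullet> y) - (X *v y) \<bullet> y"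
    have K: "K \<ge> 0" using le[of y] by (simp add: K_def)
    \<comment> \<open>The form along \<open>v + s y\<close> is \<open>2 s |y|\<^sup>2 + s\<^sup>2 K\<close>. The minimizer is \<open>- |y|\<^sup>2 / K\<close>;
      \<open>K + 1\<close> avoids dividing by zero and still makes the value negative.\<close>
    define s where "s = - (y \<bullet> y) / (K + 1)"
    have "s\<^sup>2 * K \<le> s\<^sup>2 * (K + 1)" by (simp add: mult_left_mono)
    also have "\<dots> = - s * (y \<bullet> y)" 
    proof -
      have "s * (K + 1) = - (y \<bullet> y)" using K by (simp add: s_def)
      then show ?thesis by (simp add: power2_eq_square mult.assoc)
    qed
    finally have "0 \<le> s * (y \<bullet> y)" using nonneg[of s] by (simp add: K_def)
    moreover have "s < 0" using yy K by (simp add: s_def)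
    ultimately show False using yy by (simp add: zero_le_mult_iff)
  qed
  then have "X *v v = m *\<^sub>R v" by (simp add: y_def)
  then show thesis
    using that[of v] v le unfolding m_def by (metis mem_sphere_0)
qed

lemma max_eigenvalue_maximizes_quadratic_form:
  fixes X :: "real^'n^'n"
  assumes X: "transpose X = X"
  shows "\<exists>v. norm v = 1 \<and> (X *v v) \<bullet> v = max_eigenvalue X"
    and "(X *v w) \<bullet> w \<le> max_eigenvalue X * (w \<bullet> w)"
    and "eigenvalues X \<noteq> {}"
proof -
  obtain v where v: "norm v = 1" "X *v v = ((X *v v) \<bullet> v) *\<^sub>R v"
    "\<And>w. (X *v w) \<bullet> w \<le> ((X *v v) \<bullet> v) * (w \<bullet> w)"
    using rayleigh_maximum_is_eigenvalue[OF X] by blast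
  have in_ev: "(X *v v) \<bullet> v \<in> eigenvalues X"
    using v(1,2) by (auto simp: eigenvalues_def intro!: exI[of _ v])
  have "c \<le> (X *v v) \<bullet> v" if c: "c \<in> eigenvalues X" for c
  proof -
    obtain w where w: "w \<noteq> 0" "X *v w = c *\<^sub>R w" using c by (auto simp: eigenvalues_def)
    show ?thesis using v(3)[of w] w by simp
  qed
  then have "max_eigenvalue X = (X *v v) \<bullet> v"
    unfolding max_eigenvalue_def using in_ev finite_eigenvalues_symmetric[OF X]
    by (intro Max_eqI) auto
  then show "\<exists>v. norm v = 1 \<and> (X *v v) \<bullet> v = max_eigenvalue X"
    and "(X *v w) \<bullet> w \<le> max_eigenvalue X * (w \<bullet> w)"
    using v(1) v(3)[of w] by (auto intro: exI[of _ v])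
  show "eigenvalues X \<noteq> {}" using in_ev by auto
qed

lemma max_eigenvalue_uminus:
  fixes X :: "real^'n^'n"
  assumes X: "transpose X = X"
  shows "max_eigenvalue (- X) = - min_eigenvalue X"
proof -
  have neg: "(- X) *v v = - (X *v v)" for v
    using matrix_vector_mult_diff_rdistrib[of 0 X v] by simp
  have "eigenvalues (- X) = uminus ` eigenvalues X"
  proof -
    have "- (X *v v) = c *\<^sub>R v \<longleftrightarrow> X *v v = (- c) *\<^sub>R v" for c v
      by (metis minus_minus scaleR_minus_left)
    then have "c \<in> eigenvalues (- X) \<longleftrightarrow> - c \<in> eigenvalues X" for c
      unfolding eigenvalues_def mem_Collect_eq neg by simp
    moreover have "c \<in> uminus ` A \<longleftrightarrow> - c \<in> A" for c :: real and A
      by (metis image_iff minus_minus)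
    ultimately show ?thesis by blast
  qed
  then show ?thesis
    unfolding max_eigenvalue_def min_eigenvalue_def
    using finite_eigenvalues_symmetric[OF X] max_eigenvalue_maximizes_quadratic_form(3)[OF X]
    by (auto intro!: Max_eqI)
qed

text \<open>
  For a matrix \<open>X\<close> close to \<open>Y\<close>, the quadratic form of \<open>X\<close> exceeds the largest eigenvalue of
  \<open>Y\<close> by a small amount only, uniformly in the unit vector. This uniformity makes it
  unnecessary to extract a convergent subsequence of unit vectors later.
\<close>

lemma quadratic_form_perturbation:
  fixes X Y :: "real^'n^'n"
  assumes v: "norm v = 1" and Y: "transpose Y = Y"
  shows "(X *v v) \<bullet> v \<le> max_eigenvalue Y + (\<Sum>i\<in>UNIV. \<Sum>j\<in>UNIV. \<bar>(X - Y) $ i $ j\<bar>)"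
proof -
  have "((X - Y) *v v) \<bullet> v \<le> norm ((X - Y) *v v) * norm v" by (rule norm_cauchy_schwarz)
  also have "\<dots> \<le> onorm ((*v) (X - Y))"
    using onorm[OF matrix_vector_mul_bounded_linear[of "X - Y"], of v] v by simp
  also have "\<dots> \<le> (\<Sum>i\<in>UNIV. \<Sum>j\<in>UNIV. \<bar>(X - Y) $ i $ j\<bar>)"
    by (rule onorm_le_matrix_component_sum)
  finally have "((X - Y) *v v) \<bullet> v \<le> (\<Sum>i\<in>UNIV. \<Sum>j\<in>UNIV. \<bar>(X - Y) $ i $ j\<bar>)" .
  moreover have "(Y *v v) \<bullet> v \<le> max_eigenvalue Y"
    using max_eigenvalue_maximizes_quadratic_form(2)[OF Y, of v] v by (simp add: norm_eq_1)
  ultimately show ?thesis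
    by (simp add: matrix_vector_mult_diff_rdistrib inner_diff_left)
qed

section \<open>Space-time derivatives of \<open>C\<^sup>2\<close> functions\<close>

text \<open>
  The witnesses hidden in \<open>C2_on\<close>, made explicit so that the derivatives of sums and negatives
  can be read off.
\<close>

definition C2_derivs ::
    "'a::real_normed_vector set \<Rightarrow> ('a \<Rightarrow> real) \<Rightarrow> ('a \<Rightarrow> 'a \<Rightarrow>\<^sub>L real) \<Rightarrow>
     ('a \<Rightarrow> 'a \<Rightarrow>\<^sub>L 'a \<Rightarrow>\<^sub>L real) \<Rightarrow> bool" where
  "C2_derivs S f f' f'' \<longleftrightarrow>
     (\<forall>x\<in>S. (f has_derivative blinfun_apply (f' x)) (at x)) \<and>
     (\<forall>x\<in>S. (f' has_derivative blinfun_apply (f'' x)) (at x)) \<and>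
     continuous_on S f''"

lemma C2_on_iff_derivs: "C2_on S f \<longleftrightarrow> (\<exists>f' f''. C2_derivs S f f' f'')"
  by (simp add: C2_on_def C2_derivs_def)

lemma C2_derivs_add:
  assumes "C2_derivs S f f' f''" "C2_derivs S g g' g''"
  shows "C2_derivs S (\<lambda>x. f x + g x) (\<lambda>x. f' x + g' x) (\<lambda>x. f'' x + g'' x)"
proof -
  note D = assms[unfolded C2_derivs_def]
  show ?thesis
    unfolding C2_derivs_def plus_blinfun.rep_eq
    using D by (intro conjI ballI has_derivative_add continuous_on_add) simp_all
qed

lemma C2_derivs_uminus:
  assumes "C2_derivs S f f' f''"
  shows "C2_derivs S (\<lambda>x. - f x) (\<lambda>x. - f' x) (\<lambda>x. - f'' x)"
  using assms unfolding C2_derivs_def uminus_blinfun.rep_eq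
  by (intro conjI ballI has_derivative_minus continuous_on_minus) simp_all

text \<open>
  The function \<open>|x - a|\<^sup>4\<close> turns a maximum at \<open>a\<close> into a strict one without changing the
  derivatives up to order two at \<open>a\<close>. The fourth power is needed because \<open>|x - a|\<^sup>2\<close> would
  change the Hessian at \<open>a\<close>, and \<open>|x - a|\<^sup>3\<close> is awkward to differentiate at \<open>a\<close>.
\<close>

lemma C2_derivs_quartic:
  fixes a :: "'a::real_inner"
  obtains q' q'' where
    "C2_derivs S (\<lambda>x. ((x - a) \<bullet> (x - a))\<^sup>2) q' q''" "q' a = 0" "q'' a = 0"
proof
  let ?q' = "\<lambda>x. (4 * ((x - a) \<bullet> (x - a))) *\<^sub>R blinfun_inner_right (x - a)"
  let ?q'' = "\<lambda>x. 4 *\<^sub>R (((x - a) \<bullet> (x - a)) *\<^sub>R Blinfun blinfun_inner_right)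
     + 8 *\<^sub>R (blinfun_scaleR_left (blinfun_inner_right (x - a)) o\<^sub>L blinfun_inner_right (x - a))"
  have B: "blinfun_apply (Blinfun blinfun_inner_right) = blinfun_inner_right"
    by (rule bounded_linear_Blinfun_apply[OF bounded_linear_blinfun_inner_right])
  have inner_deriv: "((\<lambda>x. blinfun_inner_right (x - a)) has_derivative blinfun_inner_right) (at x)"
    for x
    by (rule bounded_linear.has_derivative[OF bounded_linear_blinfun_inner_right,
        where g = "\<lambda>x. x - a" and g' = "\<lambda>h. h"])
       (auto intro!: derivative_eq_intros)
  show "C2_derivs S (\<lambda>x. ((x - a) \<bullet> (x - a))\<^sup>2) ?q' ?q''"
    unfolding C2_derivs_def
  proof (intro conjI ballI)
    fix x
    show "((\<lambda>x. ((x - a) \<bullet> (x - a))\<^sup>2) has_derivative blinfun_apply (?q' x)) (at x)"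
      by (auto intro!: derivative_eq_intros simp: blinfun.bilinear_simps inner_commute algebra_simps)
    show "(?q' has_derivative blinfun_apply (?q'' x)) (at x)"
      by (rule derivative_eq_intros inner_deriv refl)+
         (auto simp: fun_eq_iff blinfun.bilinear_simps B inner_commute algebra_simps
            intro!: blinfun_eqI)
  next
    show "continuous_on S ?q''"
      by (intro continuous_intros bounded_linear.continuous_on[OF bounded_linear_blinfun_inner_right]
          bounded_linear.continuous_on[OF bounded_linear_blinfun_scaleR_left]
          bounded_bilinear.continuous_on[OF bounded_bilinear_blinfun_compose])
  qed
  have zero: "blinfun_inner_right (0::'a) = 0" by (rule blinfun_eqI) simp
  show "?q' a = 0" "?q'' a = 0" by (simp_all add: zero)
qed

lemma deriv_along_line:
  assumes "(f has_derivative F) (at z)"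
  shows "((\<lambda>s. f (z + s *\<^sub>R v)) has_field_derivative F v) (at 0)"
proof -
  have "((\<lambda>s. f (z + s *\<^sub>R v)) has_derivative (\<lambda>s. F (s *\<^sub>R v))) (at 0)"
  proof -
    have "((\<lambda>s. z + s *\<^sub>R v) has_derivative (\<lambda>s. s *\<^sub>R v)) (at 0)"
      by (auto intro!: derivative_eq_intros)
    moreover have "(f has_derivative F) (at (z + 0 *\<^sub>R v))" using assms by simp
    ultimately show ?thesis by (rule has_derivative_compose)
  qed
  moreover have "(\<lambda>s. F (s *\<^sub>R v)) = (*) (F v)"
    using linear_scale[OF has_derivative_linear[OF assms]] by (simp add: fun_eq_iff)
  ultimately show ?thesis by (simp add: has_field_derivative_def)
qed

lemma space_partial_eq:
  assumes "(f has_derivative F) (at z)"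
  shows "space_partial i f z = F (axis i 1, 0)"
  using DERIV_imp_deriv[OF deriv_along_line[OF assms, of "(axis i 1, 0)"]]
  by (simp add: space_partial_def plus_prod_def)

text \<open>
  The coordinatewise operators are entries of the Frechet derivatives. For the Hessian this uses
  that \<open>S\<close> is open: the inner partial derivative is identified with an entry of \<open>f'\<close> on a whole
  neighbourhood of \<open>z\<close> before it is differentiated again.
\<close>

lemma spacetime_derivs_eq:
  assumes S: "open S" "z \<in> S" and f: "C2_derivs S f f' f''"
  shows "time_deriv f z = f' z (0, 1)"
    and "space_grad f z = (\<chi> i. f' z (axis i 1, 0))"
    and "space_hess f z = (\<chi> i j. f'' z (axis i 1, 0) (axis j 1, 0))"
proof -
  have f1: "(f has_derivative f' y) (at y)" if "y \<in> S" for y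
    using f that by (simp add: C2_derivs_def)
  have f2: "(f' has_derivative f'' z) (at z)" using f S by (simp add: C2_derivs_def)
  have "((\<lambda>s. f (fst z, s)) has_derivative (\<lambda>s. f' z (0, s))) (at (snd z))"
  proof -
    have "((\<lambda>s. (fst z, s)) has_derivative (\<lambda>s. (0, s))) (at (snd z))"
      by (auto intro!: derivative_eq_intros)
    moreover have "(f has_derivative f' z) (at (fst z, snd z))" using f1[OF S(2)] by simp
    ultimately show ?thesis by (rule has_derivative_compose)
  qed
  moreover have "(\<lambda>s. f' z (0, s)) = (*) (f' z (0, 1))"
  proof
    show "f' z (0, s) = f' z (0, 1) * s" for s
      using blinfun.scaleR_right[of "f' z" s "(0, 1)"] by simp
  qed
  ultimately have "((\<lambda>s. f (fst z, s)) has_field_derivative f' z (0, 1)) (at (snd z))"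
    by (simp add: has_field_derivative_def)
  then show "time_deriv f z = f' z (0, 1)"
    by (simp add: time_deriv_def DERIV_imp_deriv)
  show "space_grad f z = (\<chi> i. f' z (axis i 1, 0))"
    using space_partial_eq[OF f1[OF S(2)]] by (simp add: space_grad_def)
  have "space_partial i (space_partial j f) z = f'' z (axis i 1, 0) (axis j 1, 0)" for i j
  proof -
    have "((\<lambda>y. f' y (axis j 1, 0)) has_derivative (\<lambda>h. f'' z h (axis j 1, 0))) (at z)"
      by (rule derivative_eq_intros f2 refl)+ (simp add: blinfun.bilinear_simps)
    then have "(space_partial j f has_derivative (\<lambda>h. f'' z h (axis j 1, 0))) (at z)"
      by (rule has_derivative_transform_within_open[OF _ S])
         (simp add: space_partial_eq[OF f1])
    then show ?thesis by (rule space_partial_eq)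
  qed
  then show "space_hess f z = (\<chi> i j. f'' z (axis i 1, 0) (axis j 1, 0))"
    by (simp add: space_hess_def)
qed

lemma transpose_space_hess:
  assumes S: "open S" "z \<in> S" and f: "C2_on S f"
  shows "transpose (space_hess f z) = space_hess f z"
proof -
  obtain f' f'' where D: "C2_derivs S f f' f''" using f C2_on_iff_derivs by blast
  have "f'' z h k = f'' z k h" for h k
    by (rule second_derivative_symmetric[OF S, of f f']) (use D S in \<open>auto simp: C2_derivs_def\<close>)
  then show ?thesis
    by (simp add: spacetime_derivs_eq[OF S D] transpose_def vec_eq_iff)
qed

lemma C2_on_continuous_derivs:
  assumes S: "open S" and f: "C2_on S f"
  shows "continuous_on S f" "continuous_on S (time_deriv f)"
    "continuous_on S (space_grad f)" "continuous_on S (space_hess f)"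
proof -
  obtain f' f'' where D: "C2_derivs S f f' f''" using f C2_on_iff_derivs by blast
  show "continuous_on S f"
    using D by (auto simp: C2_derivs_def intro!: continuous_at_imp_continuous_on has_derivative_continuous)
  have f': "continuous_on S f'"
    using D by (auto simp: C2_derivs_def intro!: continuous_at_imp_continuous_on has_derivative_continuous)
  have f'': "continuous_on S f''" using D by (simp add: C2_derivs_def)
  note coord = spacetime_derivs_eq[OF S _ D]
  show "continuous_on S (time_deriv f)"
    by (rule continuous_on_eq[of _ "\<lambda>z. f' z (0, 1)"])
       (auto simp: coord intro!: continuous_intros f')
  show "continuous_on S (space_grad f)"
    by (rule continuous_on_eq[of _ "\<lambda>z. \<chi> i. f' z (axis i 1, 0)"])
       (auto simp: coord intro!: continuous_intros f')
  show "continuous_on S (space_hess f)"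
    by (rule continuous_on_eq[of _ "\<lambda>z. \<chi> i j. f'' z (axis i 1, 0) (axis j 1, 0)"])
       (auto simp: coord intro!: continuous_intros f'')
qed

lemma spacetime_derivs_uminus:
  assumes S: "open S" "z \<in> S" and f: "C2_on S f"
  shows "time_deriv (\<lambda>z. - f z) z = - time_deriv f z"
    and "space_grad (\<lambda>z. - f z) z = - space_grad f z"
    and "space_hess (\<lambda>z. - f z) z = - space_hess f z"
proof -
  obtain f' f'' where D: "C2_derivs S f f' f''" using f C2_on_iff_derivs by blast
  note c = spacetime_derivs_eq[OF S D] spacetime_derivs_eq[OF S C2_derivs_uminus[OF D]]
  show "time_deriv (\<lambda>z. - f z) z = - time_deriv f z"
    and "space_grad (\<lambda>z. - f z) z = - space_grad f z"
    and "space_hess (\<lambda>z. - f z) z = - space_hess f z"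
    unfolding c by (simp_all add: vec_eq_iff uminus_blinfun.rep_eq)
qed

lemma spacetime_derivs_add_quartic:
  fixes a :: "(real^'n) \<times> real"
  assumes S: "open S" "a \<in> S" and f: "C2_on S f"
  shows "C2_on S (\<lambda>z. f z + ((z - a) \<bullet> (z - a))\<^sup>2)"
    and "time_deriv (\<lambda>z. f z + ((z - a) \<bullet> (z - a))\<^sup>2) a = time_deriv f a"
    and "space_grad (\<lambda>z. f z + ((z - a) \<bullet> (z - a))\<^sup>2) a = space_grad f a"
    and "space_hess (\<lambda>z. f z + ((z - a) \<bullet> (z - a))\<^sup>2) a = space_hess f a"
proof -
  obtain f' f'' where D: "C2_derivs S f f' f''" using f C2_on_iff_derivs by blast
  obtain q' q'' where Q: "C2_derivs S (\<lambda>z. ((z - a) \<bullet> (z - a))\<^sup>2) q' q''" "q' a = 0" "q'' a = 0"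
    by (rule C2_derivs_quartic)
  note DQ = C2_derivs_add[OF D Q(1)]
  show "C2_on S (\<lambda>z. f z + ((z - a) \<bullet> (z - a))\<^sup>2)" using DQ C2_on_iff_derivs by blast
  show "time_deriv (\<lambda>z. f z + ((z - a) \<bullet> (z - a))\<^sup>2) a = time_deriv f a"
    and "space_grad (\<lambda>z. f z + ((z - a) \<bullet> (z - a))\<^sup>2) a = space_grad f a"
    and "space_hess (\<lambda>z. f z + ((z - a) \<bullet> (z - a))\<^sup>2) a = space_hess f a"
    unfolding spacetime_derivs_eq[OF S D] spacetime_derivs_eq[OF S DQ] by (simp_all add: Q)
qed

section \<open>Stability of subsolutions\<close>

text \<open>
  If \<open>w\<^sub>0 - \<phi>\<close> has a maximum at \<open>a\<close>, subtracting \<open>|z - a|\<^sup>4\<close> makes it strict with a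
  quantitative gap: at distance at least \<open>e\<close> from \<open>a\<close> the value has dropped by \<open>e\<^sup>4\<close>. Once
  \<open>w j\<close> is uniformly within \<open>e\<^sup>4 / 2\<close> of \<open>w\<^sub>0\<close>, no point that far away can compete with \<open>a\<close>.
  Hence a maximizer over one fixed compact ball around \<open>a\<close> is eventually a maximizer over all
  of \<open>S\<close>, and the maximizers converge to \<open>a\<close>. That convergence is uniform on all of \<open>S\<close>, and
  not only locally, is what makes the maxima global, although \<open>S\<close> may be unbounded.
\<close>

lemma maxima_of_perturbed_limit:
  fixes w :: "nat \<Rightarrow> 'a::euclidean_space \<Rightarrow> real"
  assumes S: "open S" "a \<in> S"
    and w: "\<And>j. continuous_on S (w j)" and lim: "uniform_limit S w w\<^sub>0 sequentially"
    and \<phi>: "continuous_on S \<phi>"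
    and max: "\<And>z. z \<in> S \<Longrightarrow> w\<^sub>0 z - \<phi> z \<le> w\<^sub>0 a - \<phi> a"
  obtains b where "\<And>j. b j \<in> S" "b \<longlonglongrightarrow> a"
    "\<forall>\<^sub>F j in sequentially. \<forall>z\<in>S.
       w j z - (\<phi> z + ((z - a) \<bullet> (z - a))\<^sup>2) \<le> w j (b j) - (\<phi> (b j) + ((b j - a) \<bullet> (b j - a))\<^sup>2)"
proof -
  define g where "g = (\<lambda>j z. w j z - (\<phi> z + ((z - a) \<bullet> (z - a))\<^sup>2))"
  obtain R where R: "R > 0" "cball a R \<subseteq> S" using S open_contains_cball by blast
  have "\<exists>b\<in>cball a R. \<forall>z\<in>cball a R. g j z \<le> g j b" for j
  proof (rule continuous_attains_sup)
    show "continuous_on (cball a R) (g j)" unfolding g_def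
      by (intro continuous_intros continuous_on_subset[OF w R(2)] continuous_on_subset[OF \<phi> R(2)])
  qed (use R in auto)
  then obtain b where b: "\<And>j. b j \<in> cball a R" "\<And>j z. z \<in> cball a R \<Longrightarrow> g j z \<le> g j (b j)"
    by metis
  have far: "\<forall>\<^sub>F j in sequentially. \<forall>z\<in>S. e \<le> dist z a \<longrightarrow> g j z < g j a" if e: "e > 0" for e
  proof -
    have "\<forall>\<^sub>F j in sequentially. \<forall>z\<in>S. dist (w j z) (w\<^sub>0 z) < e^4 / 2"
      using uniform_limitD[OF lim, of "e^4 / 2"] e by simp
    then show ?thesis
    proof eventually_elim
      case (elim j)
      show ?case
      proof (intro ballI impI)
        fix z assume z: "z \<in> S" "e \<le> dist z a"
        have "e^4 \<le> (norm (z - a))^4" using z e by (intro power_mono) (auto simp: dist_norm)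
        also have "\<dots> = ((z - a) \<bullet> (z - a))\<^sup>2" by (simp add: power2_norm_eq_inner[symmetric])
        finally have "e^4 \<le> ((z - a) \<bullet> (z - a))\<^sup>2" .
        moreover have "w j z < w\<^sub>0 z + e^4 / 2" "w\<^sub>0 a < w j a + e^4 / 2"
          using bspec[OF elim z(1)] bspec[OF elim S(2)] unfolding dist_real_def by linarith+
        ultimately have "w j z - (\<phi> z + ((z - a) \<bullet> (z - a))\<^sup>2) < w j a - \<phi> a"
          using max[OF z(1)] by linarith
        then show "g j z < g j a" by (simp add: g_def)
      qed
    qed
  qed
  have ga: "g j a \<le> g j (b j)" for j using b(2)[of a j] R by simp
  have bS: "b j \<in> S" for j using b R by auto
  show thesis
  proof (rule that[OF bS])
    show "b \<longlonglongrightarrow> a"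
    proof (rule tendstoI)
      fix e :: real assume "e > 0"
      from far[OF this] show "\<forall>\<^sub>F j in sequentially. dist (b j) a < e"
        by eventually_elim (meson bS ga not_le)
    qed
    show "\<forall>\<^sub>F j in sequentially. \<forall>z\<in>S.
       w j z - (\<phi> z + ((z - a) \<bullet> (z - a))\<^sup>2) \<le> w j (b j) - (\<phi> (b j) + ((b j - a) \<bullet> (b j - a))\<^sup>2)"
      using far[OF R(1)]
    proof eventually_elim
      case (elim j)
      have "g j z \<le> g j (b j)" if "z \<in> S" for z
        using elim that b(2)[of z j] ga[of j] by (cases "z \<in> cball a R") (auto simp: dist_commute intro: less_imp_le order_trans)
      then show ?case by (simp add: g_def)
    qed
  qed
qed

text \<open>
  The two cases of the definition become one inequality with some unit vector \<open>v\<close> in the second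
  order term: the normalised gradient where the gradient does not vanish, and otherwise an
  eigenvector for the largest eigenvalue. The limit \<open>p \<rightarrow> \<infinity>\<close> can then be taken without
  knowing which case occurs along the sequence.
\<close>

lemma visc_subsol_p_unit_direction:
  assumes S: "open S" "z \<in> S" and u: "visc_subsol_p p S u" and p: "p \<ge> 2"
    and \<phi>: "C2_on S \<phi>" and max: "\<And>y. y \<in> S \<Longrightarrow> u y - \<phi> y \<le> u z - \<phi> z"
  obtains v where "norm v = 1" "space_grad \<phi> z \<noteq> 0 \<Longrightarrow> v = sgn (space_grad \<phi> z)"
    "time_deriv \<phi> z \<le> 1 / p * trace (space_hess \<phi> z) + (p - 2) / p * ((space_hess \<phi> z *v v) \<bullet> v)"
proof -
  have "C2_on S \<phi> \<and> z \<in> S \<and> (\<forall>y\<in>S. u y - \<phi> y \<le> u z - \<phi> z)" using \<phi> S max by blast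
  from u[unfolded visc_subsol_p_def, THEN conjunct2, THEN conjunct2, rule_format, OF this]
  have visc: "if space_grad \<phi> z \<noteq> 0 then time_deriv \<phi> z - norm_p_laplacian p \<phi> z \<le> 0
    else time_deriv \<phi> z - 1 / p * trace (space_hess \<phi> z)
      - (p - 2) / p * max_eigenvalue (space_hess \<phi> z) \<le> 0"
    using p by (simp split: if_splits)
  show ?thesis
  proof (cases "space_grad \<phi> z = 0")
    case True
    obtain v where "norm v = 1" "(space_hess \<phi> z *v v) \<bullet> v = max_eigenvalue (space_hess \<phi> z)"
      using max_eigenvalue_maximizes_quadratic_form(1)[OF transpose_space_hess[OF S \<phi>]] by blast
    moreover have "time_deriv \<phi> z - 1 / p * trace (space_hess \<phi> z)
        - (p - 2) / p * max_eigenvalue (space_hess \<phi> z) \<le> 0"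
      using visc True by simp
    ultimately show ?thesis using that[of v] True by simp
  next
    case False
    have "time_deriv \<phi> z - norm_p_laplacian p \<phi> z \<le> 0"
      using visc False by simp
    then show ?thesis using that[of "sgn (space_grad \<phi> z)"] False
      by (simp add: norm_sgn norm_p_laplacian_def norm_inf_laplacian_def)
  qed
qed

lemma continuous_on_iff_semicontinuous: "continuous_on S u \<longleftrightarrow> usc_on S u \<and> lsc_on S u"
  unfolding continuous_on_def order_tendsto_iff usc_on_def lsc_on_def by blast

text \<open>
  At the maxima \<open>b j\<close> of the perturbed problem the \<open>p\<close>-inequality holds with a unit direction
  \<open>v j\<close>. As \<open>q j \<rightarrow> \<infinity>\<close> the trace term disappears and the factor \<open>(q - 2) / q\<close> tends to 1. If
  the limiting gradient is nonzero, the directions converge to its normalisation. If it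
  vanishes, nothing is known about \<open>v j\<close>, which may come from either case of the definition;
  but every unit direction is controlled by the largest eigenvalue of the limiting Hessian.
\<close>

lemma visc_subsol_inf_uniform_limit:
  fixes S :: "((real^'n) \<times> real) set" and q :: "nat \<Rightarrow> real"
  assumes S: "open S" and q: "filterlim q at_top sequentially"
    and w: "\<And>j. continuous_on S (w j)" "\<And>j. visc_subsol_p (q j) S (w j)"
    and lim: "uniform_limit S w w\<^sub>0 sequentially"
  shows "visc_subsol_inf S w\<^sub>0"
proof -
  have usc: "usc_on S w\<^sub>0"
    using uniform_limit_theorem[OF _ lim] w continuous_on_iff_semicontinuous by auto
  have "if space_grad \<phi> a \<noteq> 0 then time_deriv \<phi> a - norm_inf_laplacian \<phi> a \<le> 0
        else time_deriv \<phi> a - max_eigenvalue (space_hess \<phi> a) \<le> 0"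
    if \<phi>: "C2_on S \<phi>" and a: "a \<in> S" and max: "\<forall>z\<in>S. w\<^sub>0 z - \<phi> z \<le> w\<^sub>0 a - \<phi> a" for \<phi> a
  proof -
    define \<psi> where "\<psi> = (\<lambda>z. \<phi> z + ((z - a) \<bullet> (z - a))\<^sup>2)"
    have \<psi>: "C2_on S \<psi>" and jet: "time_deriv \<psi> a = time_deriv \<phi> a"
        "space_grad \<psi> a = space_grad \<phi> a" "space_hess \<psi> a = space_hess \<phi> a"
      unfolding \<psi>_def by (rule spacetime_derivs_add_quartic[OF S a \<phi>])+
    obtain b where b: "\<And>j. b j \<in> S" "b \<longlonglongrightarrow> a"
      and bmax: "\<forall>\<^sub>F j in sequentially. \<forall>z\<in>S. w j z - \<psi> z \<le> w j (b j) - \<psi> (b j)"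
      using maxima_of_perturbed_limit[OF S a w(1) lim C2_on_continuous_derivs(1)[OF S \<phi>]] max
      unfolding \<psi>_def by blast
    have lims: "(\<lambda>j. time_deriv \<psi> (b j)) \<longlonglongrightarrow> time_deriv \<phi> a"
        "(\<lambda>j. space_grad \<psi> (b j)) \<longlonglongrightarrow> space_grad \<phi> a"
        "(\<lambda>j. space_hess \<psi> (b j)) \<longlonglongrightarrow> space_hess \<phi> a"
      unfolding jet[symmetric]
      by (rule continuous_on_tendsto_compose[OF _ b(2) a];
          use C2_on_continuous_derivs[OF S \<psi>] b in simp)+
    define X where "X = (\<lambda>j. space_hess \<psi> (b j))"
    have X: "X \<longlonglongrightarrow> space_hess \<phi> a" using lims(3) by (simp add: X_def)
    have tr: "(\<lambda>j. trace (X j)) \<longlonglongrightarrow> trace (space_hess \<phi> a)"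
      unfolding trace_def by (intro tendsto_intros X)
    have q0: "(\<lambda>j. 1 / q j) \<longlonglongrightarrow> 0"
      by (rule tendsto_divide_0[OF tendsto_const filterlim_at_top_imp_at_infinity[OF q]])
    have "(\<lambda>j. 1 - 2 * (1 / q j)) \<longlonglongrightarrow> 1 - 2 * 0" by (intro tendsto_intros q0)
    moreover have "\<forall>\<^sub>F j in sequentially. 1 - 2 * (1 / q j) = (q j - 2) / q j"
      using filterlim_at_top_dense[THEN iffD1, OF q, rule_format, of 0]
      by eventually_elim (simp add: field_simps)
    ultimately have q1: "(\<lambda>j. (q j - 2) / q j) \<longlonglongrightarrow> 1"
      by (simp add: tendsto_cong)
    have q2: "\<forall>\<^sub>F j in sequentially. 2 \<le> q j" using q by (simp add: filterlim_at_top)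
    have "\<forall>\<^sub>F j in sequentially. \<exists>v. norm v = 1 \<and>
        (space_grad \<psi> (b j) \<noteq> 0 \<longrightarrow> v = sgn (space_grad \<psi> (b j))) \<and>
        time_deriv \<psi> (b j) \<le> 1 / q j * trace (X j) + (q j - 2) / q j * ((X j *v v) \<bullet> v)"
      using q2 bmax
    proof eventually_elim
      case (elim j)
      show ?case unfolding X_def
        by (rule visc_subsol_p_unit_direction[OF S b(1) w(2) elim(1) \<psi>, of j]) (use elim(2) in auto)
    qed
    then obtain v where ev: "\<forall>\<^sub>F j in sequentially. norm (v j) = 1 \<and>
        (space_grad \<psi> (b j) \<noteq> 0 \<longrightarrow> v j = sgn (space_grad \<psi> (b j))) \<and>
        time_deriv \<psi> (b j) \<le> 1 / q j * trace (X j) + (q j - 2) / q j * ((X j *v v j) \<bullet> v j)"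
      unfolding eventually_ex by blast
    show ?thesis
    proof (cases "space_grad \<phi> a = 0")
      case False
      define s where "s = (\<lambda>j. sgn (space_grad \<psi> (b j)))"
      have s: "s \<longlonglongrightarrow> sgn (space_grad \<phi> a)" unfolding s_def by (intro tendsto_sgn lims False)
      have ev': "\<forall>\<^sub>F j in sequentially. time_deriv \<psi> (b j)
          \<le> 1 / q j * trace (X j) + (q j - 2) / q j * ((X j *v s j) \<bullet> s j)"
        using ev tendsto_imp_eventually_ne[OF lims(2) False]
        by eventually_elim (auto simp: s_def)
      have "(\<lambda>j. X j *v s j) \<longlonglongrightarrow> space_hess \<phi> a *v sgn (space_grad \<phi> a)"
        unfolding matrix_vector_mult_def by (intro tendsto_intros X s)
      then have "(\<lambda>j. 1 / q j * trace (X j) + (q j - 2) / q j * ((X j *v s j) \<bullet> s j)) \<longlonglongrightarrow>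
          0 * trace (space_hess \<phi> a) + 1 * norm_inf_laplacian \<phi> a"
        unfolding norm_inf_laplacian_def by (intro tendsto_intros q0 q1 tr s)
      from tendsto_le[OF _ this lims(1) ev'] False show ?thesis by simp
    next
      case True
      let ?Y = "space_hess \<phi> a"
      define E where "E = (\<lambda>j. \<Sum>k\<in>UNIV. \<Sum>l\<in>UNIV. \<bar>(X j - ?Y) $ k $ l\<bar>)"
      have "E \<longlonglongrightarrow> (\<Sum>k\<in>UNIV. \<Sum>l\<in>UNIV. \<bar>(?Y - ?Y) $ k $ l\<bar>)"
        unfolding E_def by (intro tendsto_intros X)
      then have E: "E \<longlonglongrightarrow> 0" by simp
      have ev': "\<forall>\<^sub>F j in sequentially. time_deriv \<psi> (b j)
          \<le> 1 / q j * trace (X j) + (q j - 2) / q j * (max_eigenvalue ?Y + E j)"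
        using ev q2
      proof eventually_elim
        case (elim j)
        have "(X j *v v j) \<bullet> v j \<le> max_eigenvalue ?Y + E j" unfolding E_def
          using elim by (intro quadratic_form_perturbation transpose_space_hess[OF S a \<phi>]) auto
        then have "(q j - 2) / q j * ((X j *v v j) \<bullet> v j)
            \<le> (q j - 2) / q j * (max_eigenvalue ?Y + E j)"
          using elim by (intro mult_left_mono) auto
        then show ?case using elim by linarith
      qed
      have "(\<lambda>j. 1 / q j * trace (X j) + (q j - 2) / q j * (max_eigenvalue ?Y + E j)) \<longlonglongrightarrow>
          0 * trace ?Y + 1 * (max_eigenvalue ?Y + 0)"
        by (intro tendsto_intros q0 q1 tr E)
      from tendsto_le[OF _ this lims(1) ev'] True show ?thesis by simp
    qed
  qed
  with usc show ?thesis unfolding visc_subsol_inf_def by blast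
qed

section \<open>Duality of subsolutions and supersolutions\<close>

text \<open>
  The operator is odd in \<open>\<phi>\<close>, and the largest and the smallest eigenvalue are exchanged by
  \<open>X \<mapsto> - X\<close>. Negation therefore exchanges subsolutions and supersolutions, so that stability
  needs to be proved for subsolutions only.
\<close>

lemma norm_inf_laplacian_uminus:
  fixes \<phi> :: "(real^'n) \<times> real \<Rightarrow> real"
  assumes "open S" "z \<in> S" "C2_on S \<phi>"
  shows "norm_inf_laplacian (\<lambda>z. - \<phi> z) z = - norm_inf_laplacian \<phi> z"
proof -
  have "(- A) *v (- x) = A *v x" for A :: "real^'n^'n" and x
    by (simp add: matrix_vector_mult_def vec_eq_iff)
  then show ?thesis
    by (simp add: norm_inf_laplacian_def spacetime_derivs_uminus[OF assms] sgn_minus)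
qed

lemma trace_uminus: "trace (- A) = - trace (A::real^'n^'n)"
  by (simp add: trace_def sum_negf)

lemma C2_on_uminus: "C2_on S \<phi> \<Longrightarrow> C2_on S (\<lambda>z. - \<phi> z)"
  using C2_derivs_uminus C2_on_iff_derivs by blast

lemma in_L_infinity_uminus: "in_L_infinity S u \<Longrightarrow> in_L_infinity S (\<lambda>z. - u z)"
  by (auto simp: in_L_infinity_def)

lemma visc_supersol_p_imp_subsol_uminus:
  assumes S: "open S" and p: "p \<ge> 2" and u: "visc_supersol_p p S u"
  shows "visc_subsol_p p S (\<lambda>z. - u z)"
  unfolding visc_subsol_p_def
proof (intro conjI allI impI)
  show "usc_on S (\<lambda>z. - u z)"
    using u by (auto simp: visc_supersol_p_def lsc_on_def usc_on_def minus_less_iff)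
  show "in_L_infinity S (\<lambda>z. - u z)"
    using u by (simp add: visc_supersol_p_def in_L_infinity_uminus)
  fix \<phi> z
  assume H: "C2_on S \<phi> \<and> z \<in> S \<and> (\<forall>\<zeta>\<in>S. - u \<zeta> - \<phi> \<zeta> \<le> - u z - \<phi> z)"
  then have *: "open S" "z \<in> S" "C2_on S \<phi>" using S by auto
  have "C2_on S (\<lambda>z. - \<phi> z) \<and> z \<in> S \<and> (\<forall>\<zeta>\<in>S. u z - - \<phi> z \<le> u \<zeta> - - \<phi> \<zeta>)"
    using H by (auto intro: C2_on_uminus simp: algebra_simps)
  from u[unfolded visc_supersol_p_def, THEN conjunct2, THEN conjunct2, rule_format, OF this]
  show "if space_grad \<phi> z \<noteq> 0 then time_deriv \<phi> z - norm_p_laplacian p \<phi> z \<le> 0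
        else time_deriv \<phi> z - 1 / p * trace (space_hess \<phi> z)
          - (p - 2) / p * (if 2 \<le> p then max_eigenvalue (space_hess \<phi> z)
                           else min_eigenvalue (space_hess \<phi> z)) \<le> 0"
    using p max_eigenvalue_uminus[of "- space_hess \<phi> z"] transpose_space_hess[OF * ]
      transpose_space_hess[OF *(1,2) C2_on_uminus[OF *(3)]]
    by (auto simp: norm_p_laplacian_def norm_inf_laplacian_uminus[OF *] trace_uminus
        spacetime_derivs_uminus[OF *] split: if_splits)
qed

lemma visc_subsol_inf_uminus_imp_supersol:
  assumes S: "open S" and u: "visc_subsol_inf S (\<lambda>z. - u z)"
  shows "visc_supersol_inf S u"
  unfolding visc_supersol_inf_def
proof (intro conjI allI impI)
  show "lsc_on S u"
    unfolding lsc_on_def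
  proof (intro ballI allI impI)
    fix x c assume "x \<in> S" "c < u x"
    then have "\<forall>\<^sub>F y in at x within S. - u y < - c"
      using u unfolding visc_subsol_inf_def usc_on_def by (metis neg_less_iff_less)
    then show "\<forall>\<^sub>F y in at x within S. c < u y" by simp
  qed
  fix \<phi> z
  assume H: "C2_on S \<phi> \<and> z \<in> S \<and> (\<forall>\<zeta>\<in>S. u z - \<phi> z \<le> u \<zeta> - \<phi> \<zeta>)"
  then have *: "open S" "z \<in> S" "C2_on S \<phi>" using S by auto
  have "C2_on S (\<lambda>z. - \<phi> z) \<and> z \<in> S \<and> (\<forall>\<zeta>\<in>S. - u \<zeta> - - \<phi> \<zeta> \<le> - u z - - \<phi> z)"
    using H by (auto intro: C2_on_uminus simp: algebra_simps)
  from u[unfolded visc_subsol_inf_def, THEN conjunct2, rule_format, OF this]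
  show "if space_grad \<phi> z \<noteq> 0 then 0 \<le> time_deriv \<phi> z - norm_inf_laplacian \<phi> z
        else 0 \<le> time_deriv \<phi> z - min_eigenvalue (space_hess \<phi> z)"
    by (auto simp: norm_inf_laplacian_uminus[OF *] max_eigenvalue_uminus[OF transpose_space_hess[OF *]]
        spacetime_derivs_uminus[OF *] split: if_splits)
qed

theorem lemma3p12:
  fixes \<Omega> :: "((real^'n) \<times> real) set"
    and p :: "nat \<Rightarrow> real"
    and u :: "real \<Rightarrow> (real^'n) \<times> real \<Rightarrow> real"
    and r :: "nat \<Rightarrow> nat"
    and u_inf :: "(real^'n) \<times> real \<Rightarrow> real"
  assumes "open \<Omega>" and "connected \<Omega>" and "\<Omega> \<noteq> {}"
    and "\<And>k. 1 < p k"
    and "\<And>k. visc_sol_p (p k) \<Omega> (u (p k))"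
    and "strict_mono r"
    and "filterlim (\<lambda>j. p (r j)) at_top sequentially"
    and "uniform_limit \<Omega> (\<lambda>j. u (p (r j))) u_inf sequentially"
  shows "visc_sol_inf \<Omega> u_inf"
proof -
  \<comment> \<open>For \<open>p < 2\<close> the extreme eigenvalues trade places in the definitions, so the finitely many
    exponents below 2 are dropped first.\<close>
  obtain N where N: "\<And>j. p (r (j + N)) \<ge> 2"
    using assms(7) unfolding filterlim_at_top eventually_sequentially by (metis le_add2)
  define q where "q = (\<lambda>j. p (r (j + N)))"
  define w where "w = (\<lambda>j. u (q j))"
  have shift: "filterlim (\<lambda>j. j + N) sequentially sequentially" by (rule filterlim_add_const_nat_at_top)
  have q: "filterlim q at_top sequentially"
    unfolding q_def using filterlim_compose[OF assms(7) shift] .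
  have lim: "uniform_limit \<Omega> w u_inf sequentially"
    using filterlim_compose[OF assms(8) shift] by (simp add: w_def q_def)
  have sol: "visc_subsol_p (q j) \<Omega> (w j)" "visc_supersol_p (q j) \<Omega> (w j)" for j
    using assms(5) by (simp_all add: w_def q_def visc_sol_p_def)
  have cont: "continuous_on \<Omega> (w j)" for j
    using sol[of j] by (simp add: continuous_on_iff_semicontinuous visc_subsol_p_def visc_supersol_p_def)
  have "visc_subsol_inf \<Omega> u_inf"
    by (rule visc_subsol_inf_uniform_limit[OF assms(1) q cont sol(1) lim])
  moreover have "visc_subsol_inf \<Omega> (\<lambda>z. - u_inf z)"
  proof (rule visc_subsol_inf_uniform_limit[OF assms(1) q])
    show "continuous_on \<Omega> (\<lambda>z. - w j z)" for j by (intro continuous_intros cont)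
    show "visc_subsol_p (q j) \<Omega> (\<lambda>z. - w j z)" for j
      using N by (intro visc_supersol_p_imp_subsol_uminus assms(1) sol) (simp add: q_def)
    show "uniform_limit \<Omega> (\<lambda>j z. - w j z) (\<lambda>z. - u_inf z) sequentially"
      by (intro uniform_limit_intros lim)
  qed
  ultimately show ?thesis
    unfolding visc_sol_inf_def using visc_subsol_inf_uminus_imp_supersol[OF assms(1)] by blast
qed

end
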